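(* For all integers $n\ge 4$, $$\chi(QI(n,2))=\left\lceil \frac12\binom{n}{\lfloor n/2\rfloor}\right\rceil .$$
   Context: $\chi$ denotes the chromatic number. For $n\ge 4$, $QI(n,2)$ is the graph whose vertices are all partitions $\{A_1,A_2\}$ of $\{1,\dots,n\}$ into two classes, each of size at least $2$; two vertices $\{A_1,A_2\}$ and $\{B_1,B_2\}$ are adjacent if and only if they are qualitatively independent, i.e. $A_i\cap B_j\neq\emptyset$ for all $i,j\in\{1,2\}$. *)

theory Defs
  imports Complex_Main "HOL-Library.Disjoint_Sets" "Graph_Theory.Pair_Digraph"
begin

definition colourable :: "'a pair_pre_digraph \<Rightarrow> nat \<Rightarrow> bool" where
  "colourable G k \<longleftrightarrow>
     (\<exists>c. c ` pverts G \<subseteq> {..<k} \<and> (\<forall>(u, v) \<in> parcs G. c u \<noteq> c v))"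

text \<open>
  Meaningful for finite loop-free graphs only: if no \<open>k\<close> colours suffice, the value is unspecified.
\<close>
definition chromatic_number :: "'a pair_pre_digraph \<Rightarrow> nat" where
  "chromatic_number G = (LEAST k. colourable G k)"

definition qualitatively_independent :: "'a set set \<Rightarrow> 'a set set \<Rightarrow> bool" where
  "qualitatively_independent P Q \<longleftrightarrow> (\<forall>A \<in> P. \<forall>B \<in> Q. A \<inter> B \<noteq> {})"

definition QI2_verts :: "nat \<Rightarrow> nat set set set" where
  "QI2_verts n = {P. partition_on {1..n} P \<and> card P = 2 \<and> (\<forall>A \<in> P. 2 \<le> card A)}"

text \<open>The graph \<open>QI(n,2)\<close>; each edge is represented by its two orientations.\<close>
definition QI2 :: "nat \<Rightarrow> nat set set pair_pre_digraph" where
  "QI2 n = \<lparr> pverts = QI2_verts n,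
     parcs = {(P, Q). P \<in> QI2_verts n \<and> Q \<in> QI2_verts n \<and> qualitatively_independent P Q} \<rparr>"

lemma pair_graph_colourable:
  assumes "pair_graph G"
  shows "colourable G (card (pverts G))"
proof -
  interpret pair_graph G by fact
  obtain c where c: "bij_betw c (pverts G) {0..<card (pverts G)}"
    using ex_bij_betw_finite_nat[OF pair_finite_verts] by blast
  have "c u \<noteq> c v" if "(u, v) \<in> parcs G" for u v
  proof -
    have "u \<in> pverts G" "v \<in> pverts G" "u \<noteq> v"
      using in_arcsD1[OF that] in_arcsD2[OF that] pair_no_loops[OF that] by auto
    then show ?thesis using c by (auto simp: bij_betw_def inj_on_def)
  qed
  moreover have "c ` pverts G \<subseteq> {..<card (pverts G)}"
    using c by (auto simp: bij_betw_def)
  ultimately show ?thesis unfolding colourable_def by blast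
qed

lemma finite_QI2_verts: "finite (QI2_verts n)"
proof (rule finite_subset)
  show "QI2_verts n \<subseteq> Pow (Pow {1..n})"
    unfolding QI2_verts_def partition_on_def by blast
qed simp

lemma not_qualitatively_independent_self:
  assumes "P \<in> QI2_verts n"
  shows "\<not> qualitatively_independent P P"
proof -
  have "card P = 2" "disjoint P"
    using assms by (auto simp: QI2_verts_def partition_on_def)
  then obtain A B where "P = {A, B}" "A \<noteq> B" by (auto simp: card_2_iff)
  then show ?thesis using \<open>disjoint P\<close>
    by (auto simp: qualitatively_independent_def disjoint_def)
qed

lemma qualitatively_independent_sym:
  "qualitatively_independent P Q \<Longrightarrow> qualitatively_independent Q P"
  unfolding qualitatively_independent_def by (metis Int_commute)

lemma pair_graph_QI2: "pair_graph (QI2 n)"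
proof unfold_locales
  show "finite (parcs (QI2 n))"
    by (rule finite_subset[of _ "QI2_verts n \<times> QI2_verts n"])
       (auto simp: QI2_def finite_QI2_verts)
  show "symmetric (with_proj (QI2 n))"
    by (auto simp: QI2_def symmetric_def sym_def intro: qualitatively_independent_sym)
  show "fst e \<noteq> snd e" if "e \<in> parcs (QI2 n)" for e
    using that by (auto simp: QI2_def dest: not_qualitatively_independent_self)
qed (auto simp: QI2_def finite_QI2_verts)

end

theory Submission
  imports Defs
begin

text \<open>
  Write \<open>k = n div 2\<close>. A partition \<open>{A, {1..n} - A}\<close> is determined by either part, and one part has at
  most \<open>k\<close> elements. Two partitions with parts \<open>A\<close> and \<open>B\<close> fail to be qualitatively independent as soon
  as \<open>A\<close> and \<open>B\<close> are comparable or disjoint.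

  \<^bold>\<open>Lower bound.\<close> For partitions with a part of size exactly \<open>k\<close>, failure of qualitative independence
  forces the two \<open>k\<close>-sets to be equal or disjoint, because comparable sets of equal size coincide and
  two \<open>k\<close>-sets covering \<open>{1..n}\<close> must be complementary. Three pairwise disjoint \<open>k\<close>-sets do not fit
  into \<open>n \<le> 2 * k + 1\<close> points when \<open>k \<ge> 2\<close>. So each colour is used for at most two \<open>k\<close>-sets.

  \<^bold>\<open>Upper bound.\<close> The subsets of size at most \<open>k\<close> split into chains, each ending in a \<open>k\<close>-set: this
  needs only an injective map from each level below the middle to the next that adds one element
  (\<open>raise_inj\<close>). If two \<open>k\<close>-sets are disjoint, then everything in the chain of one is
  disjoint from everything in the chain of the other, so two such chains can share a colour.
  It remains to pair off the \<open>k\<close>-sets into disjoint pairs with at most one left over, that is, to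
  find a matching of the Kneser graph \<open>K(n, k)\<close> missing at most one vertex. For \<open>n = 2 * k\<close>
  complementation is a perfect matching. For \<open>n = 2 * k + 1\<close> the graph is the odd graph, which is
  connected and vertex-transitive; every such finite graph has a matching missing at most one vertex
  (\<open>near_perfect_matching_if_vertex_transitive\<close>), by an exchange argument due to Gallai.
\<close>

section \<open>Matchings missing at most one vertex\<close>

locale finite_simple_graph =
  fixes V :: "'a set" and E :: "'a set set"
  assumes finite_V: "finite V"
    and edge_subset: "e \<in> E \<Longrightarrow> e \<subseteq> V"
    and edge_card: "e \<in> E \<Longrightarrow> card e = 2"
begin

definition matching :: "'a set set \<Rightarrow> bool" where
  "matching M \<longleftrightarrow> M \<subseteq> E \<and> disjoint M"

definition maximum_matching :: "'a set set \<Rightarrow> bool" where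
  "maximum_matching M \<longleftrightarrow> matching M \<and> (\<forall>M'. matching M' \<longrightarrow> card M' \<le> card M)"

lemma finite_E: "finite E"
  by (rule finite_subset[of _ "Pow V"]) (use edge_subset finite_V in auto)

lemma matching_finite: "matching M \<Longrightarrow> finite M"
  using finite_E finite_subset unfolding matching_def by blast

lemma matching_Union_subset: "matching M \<Longrightarrow> \<Union>M \<subseteq> V"
  using edge_subset unfolding matching_def by blast

lemma matching_edge_unique:
  "matching M \<Longrightarrow> e \<in> M \<Longrightarrow> f \<in> M \<Longrightarrow> x \<in> e \<Longrightarrow> x \<in> f \<Longrightarrow> e = f"
  unfolding matching_def disjoint_def by blast

lemma matching_subset: "matching M \<Longrightarrow> N \<subseteq> M \<Longrightarrow> matching N"
  unfolding matching_def disjoint_def by blast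

lemma card_Union_matching:
  assumes "matching M"
  shows "card (\<Union>M) = 2 * card M"
proof -
  have fin: "finite e" if "e \<in> M" for e
    using that assms edge_subset finite_V finite_subset unfolding matching_def by blast
  have "card (\<Union>M) = sum card M"
    using assms fin by (intro card_Union_disjoint) (auto simp: matching_def)
  also have "\<dots> = (\<Sum>e\<in>M. 2)"
    using assms edge_card by (intro sum.cong) (auto simp: matching_def)
  finally show ?thesis by simp
qed

lemma edge_obtain_other:
  assumes "e \<in> E" "x \<in> e"
  obtains y where "e = {x, y}" "y \<noteq> x"
  using edge_card[OF assms(1)] assms(2) by (auto simp: card_2_iff)

lemma maximum_matching_exists: "\<exists>M. maximum_matching M"
proof -
  have "matching {}" by (simp add: matching_def disjoint_def)
  moreover have "card M < Suc (card E)" if "matching M" for M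
    using that card_mono[OF finite_E] by (simp add: matching_def less_Suc_eq_le)
  ultimately show ?thesis
    using ex_has_greatest_nat[of matching "{}" card "Suc (card E)"] unfolding maximum_matching_def by blast
qed

definition no_common_miss :: "'a \<Rightarrow> 'a \<Rightarrow> bool" where
  "no_common_miss u v \<longleftrightarrow> (\<forall>M. maximum_matching M \<longrightarrow> u \<in> \<Union>M \<or> v \<in> \<Union>M)"

lemma matching_insert:
  assumes "matching M" "e \<in> E" "e \<inter> \<Union>M = {}"
  shows "matching (insert e M)"
  using assms unfolding matching_def disjoint_def by blast

lemma adjacent_no_common_miss:
  assumes "{u, v} \<in> E"
  shows "no_common_miss u v"
  unfolding no_common_miss_def
proof (intro allI impI, rule ccontr)
  fix M assume max: "maximum_matching M" and "\<not> (u \<in> \<Union>M \<or> v \<in> \<Union>M)"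
  then have *: "{u, v} \<inter> \<Union>M = {}" by blast
  then have "matching (insert {u, v} M)"
    using max assms matching_insert unfolding maximum_matching_def by blast
  moreover have "{u, v} \<notin> M" using * by blast
  ultimately show False
    using max matching_finite[of M] unfolding maximum_matching_def
    by (metis card_insert_disjoint lessI not_less)
qed

text \<open>
  The exchange argument behind Gallai's lemma. Suppose \<open>M\<close> misses both \<open>u\<close> and \<open>v\<close>, and among the
  maximum matchings missing \<open>w\<close> let \<open>N\<close> share as many edges with \<open>M\<close> as possible. Then \<open>N\<close> covers
  \<open>u\<close> and \<open>v\<close>, so by counting \<open>M\<close> covers some \<open>x \<noteq> w\<close> that \<open>N\<close> misses. Swapping the \<open>M\<close>-edge
  at \<open>x\<close> into \<open>N\<close> increases the overlap with \<open>M\<close>, and \<open>w\<close> stays missed.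
\<close>

lemma no_common_miss_trans:
  assumes uw: "no_common_miss u w" and wv: "no_common_miss w v" and "u \<noteq> v"
    and w_missed: "\<exists>N. maximum_matching N \<and> w \<notin> \<Union>N"
  shows "no_common_miss u v"
  unfolding no_common_miss_def
proof (intro allI impI, rule ccontr)
  fix M assume M: "maximum_matching M" and nuv: "\<not> (u \<in> \<Union>M \<or> v \<in> \<Union>M)"
  have finM: "finite M" using M matching_finite by (simp add: maximum_matching_def)
  have "card (M \<inter> N) < Suc (card M)" for N
    using finM by (simp add: card_mono less_Suc_eq_le)
  moreover obtain N0 where "maximum_matching N0 \<and> w \<notin> \<Union>N0" using w_missed by blast
  ultimately have "\<exists>N. (maximum_matching N \<and> w \<notin> \<Union>N) \<and>
      (\<forall>N'. maximum_matching N' \<and> w \<notin> \<Union>N' \<longrightarrow> card (M \<inter> N') \<le> card (M \<inter> N))"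
    by (intro ex_has_greatest_nat) auto
  then obtain N where N: "maximum_matching N" and wN: "w \<notin> \<Union>N"
    and best: "\<And>N'. maximum_matching N' \<Longrightarrow> w \<notin> \<Union>N' \<Longrightarrow> card (M \<inter> N') \<le> card (M \<inter> N)"
    by metis
  have mM: "matching M" and mN: "matching N"
    using M N by (auto simp: maximum_matching_def)
  have finN: "finite N" using mN matching_finite by auto
  have finUM: "finite (\<Union>M)" and finUN: "finite (\<Union>N)"
    using mM mN matching_Union_subset finite_V finite_subset by blast+
  \<comment> \<open>Both matchings cover equally many vertices, and \<open>N\<close> covers at least two that \<open>M\<close> misses,
    so \<open>M\<close> covers at least two that \<open>N\<close> misses; one of these differs from \<open>w\<close>.\<close>
  have "u \<in> \<Union>N" "v \<in> \<Union>N"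
    using uw wv N wN unfolding no_common_miss_def by blast+
  then have "{u, v} \<subseteq> \<Union>N - \<Union>M" using nuv by blast
  then have "2 \<le> card (\<Union>N - \<Union>M)"
    using card_mono[of "\<Union>N - \<Union>M" "{u, v}"] finUN \<open>u \<noteq> v\<close> by simp
  moreover have "card M = card N"
    using M N unfolding maximum_matching_def by (meson le_antisym)
  then have "card (\<Union>M) = card (\<Union>N)"
    using card_Union_matching mM mN by simp
  then have "card (\<Union>M - \<Union>N) = card (\<Union>N - \<Union>M)"
    using card_Diff_subset_Int[of "\<Union>M" "\<Union>N"] card_Diff_subset_Int[of "\<Union>N" "\<Union>M"] finUM finUN
    by (metis finite_Int inf_commute)
  ultimately have "\<not> \<Union>M - \<Union>N \<subseteq> {w}"
    using card_mono[of "{w}" "\<Union>M - \<Union>N"] by auto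
  then obtain x where x: "x \<in> \<Union>M" "x \<notin> \<Union>N" "x \<noteq> w" by blast
  obtain e where e: "e \<in> M" "x \<in> e" using x by blast
  have eE: "e \<in> E" using e mM by (auto simp: matching_def)
  obtain y where y: "e = {x, y}" "y \<noteq> x" using edge_obtain_other[OF eE e(2)] .
  \<comment> \<open>Otherwise \<open>e\<close> could be added to the maximum matching \<open>N\<close>.\<close>
  have "y \<in> \<Union>N"
    using adjacent_no_common_miss[of x y] eE y x N unfolding no_common_miss_def by blast
  then obtain f where f: "f \<in> N" "y \<in> f" by blast
  have "f \<notin> M"
  proof
    assume "f \<in> M"
    then have "e = f" using matching_edge_unique[OF mM e(1), of f y] f y by simp
    then show False using f e x by blast
  qed
  let ?N' = "insert e (N - {f})"
  have "y \<notin> \<Union>(N - {f})" using matching_edge_unique[OF mN f(1) _ f(2)] by blast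
  then have "e \<inter> \<Union>(N - {f}) = {}" using y x by auto
  with matching_subset[OF mN Diff_subset] eE have "matching ?N'"
    by (rule matching_insert)
  moreover have eN: "e \<notin> N" using x e by blast
  then have "card ?N' = card N"
    using finN f(1) card_Suc_Diff1[of N f] by simp
  ultimately have "maximum_matching ?N'"
    using N unfolding maximum_matching_def by simp
  moreover have "w \<notin> \<Union>?N'" using wN x y \<open>y \<in> \<Union>N\<close> by auto
  ultimately have "card (M \<inter> ?N') \<le> card (M \<inter> N)" by (rule best)
  moreover have "M \<inter> ?N' = insert e (M \<inter> N)" using e \<open>f \<notin> M\<close> by blast
  moreover have "e \<notin> M \<inter> N" "finite (M \<inter> N)" using eN finM by auto
  ultimately show False by simp
qed

text \<open>
  If some maximum matching misses two vertices, then automorphisms carry it to maximum matchings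
  missing any prescribed vertex. This makes \<open>no_common_miss\<close> transitive along distinct endpoints,
  and since it holds for adjacent vertices, connectivity gives it for all pairs of distinct vertices:
  a contradiction.
\<close>

lemma near_perfect_matching_if_vertex_transitive:
  assumes connected: "\<And>u v. u \<in> V \<Longrightarrow> v \<in> V \<Longrightarrow> (u, v) \<in> {(x, y). {x, y} \<in> E}\<^sup>*"
    and transitive: "\<And>u v. u \<in> V \<Longrightarrow> v \<in> V \<Longrightarrow>
      \<exists>\<pi>. inj_on \<pi> V \<and> \<pi> u = v \<and> (\<forall>e\<in>E. \<pi> ` e \<in> E)"
  shows "\<exists>M. matching M \<and> card (V - \<Union>M) \<le> 1"
proof -
  obtain M where M: "maximum_matching M" using maximum_matching_exists by blast
  have mM: "matching M" using M by (simp add: maximum_matching_def)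
  have "card (V - \<Union>M) \<le> 1"
  proof (rule ccontr)
    assume big: "\<not> card (V - \<Union>M) \<le> 1"
    then have "2 \<le> card (V - \<Union>M)" by simp
    then obtain T where "T \<subseteq> V - \<Union>M" "card T = 2"
      using obtain_subset_with_card_n by metis
    then obtain u v where u: "u \<in> V" "u \<notin> \<Union>M" and v: "v \<in> V" "v \<notin> \<Union>M" "v \<noteq> u"
      by (auto simp: card_2_iff)
    have missed: "\<exists>N. maximum_matching N \<and> w \<notin> \<Union>N" if w: "w \<in> V" for w
    proof -
      obtain \<pi> where \<pi>: "inj_on \<pi> V" "\<pi> u = w" "\<forall>e\<in>E. \<pi> ` e \<in> E"
        using transitive u w by blast
      let ?N = "(`) \<pi> ` M"
      have sub: "e \<subseteq> V" if "e \<in> M" for e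
        using that mM edge_subset by (auto simp: matching_def)
      have "disjoint ?N"
        unfolding disjoint_def
      proof (intro ballI impI)
        fix a b assume "a \<in> ?N" "b \<in> ?N" "a \<noteq> b"
        then obtain e f where ef: "e \<in> M" "f \<in> M" "a = \<pi> ` e" "b = \<pi> ` f" "e \<noteq> f" by blast
        then have "e \<inter> f = {}" using mM by (auto simp: matching_def disjoint_def)
        then show "a \<inter> b = {}"
          using ef sub inj_on_image_Int[OF \<pi>(1), of e f] by simp
      qed
      then have "matching ?N" using mM \<pi>(3) by (auto simp: matching_def)
      moreover have "card ?N = card M"
        using inj_on_image_Pow[OF \<pi>(1)] sub
        by (intro card_image) (auto intro: inj_on_subset)
      ultimately have "maximum_matching ?N" using M by (simp add: maximum_matching_def)
      moreover have "w \<notin> \<Union>?N"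
      proof
        assume "w \<in> \<Union>?N"
        then obtain e x where "e \<in> M" "x \<in> e" "\<pi> x = w" by blast
        then have "x = u" using \<pi>(1,2) u(1) sub[OF \<open>e \<in> M\<close>] by (auto dest: inj_onD)
        then show False using u \<open>e \<in> M\<close> \<open>x \<in> e\<close> by blast
      qed
      ultimately show ?thesis by blast
    qed
    have in_V: "y \<in> V" if "{x, y} \<in> E" for x y using edge_subset[OF that] by simp
    have "(u, x) \<in> {(x, y). {x, y} \<in> E}\<^sup>* \<Longrightarrow> x = u \<or> no_common_miss u x" for x
    proof (induction rule: rtrancl_induct)
      case base
      then show ?case by simp
    next
      case (step y z)
      have "{y, z} \<in> E" using step by simp
      then have yz: "no_common_miss y z" and "y \<in> V"
        using adjacent_no_common_miss edge_subset by auto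
      then show ?case
        using step.IH no_common_miss_trans[OF _ yz _ missed, of u] by blast
    qed
    then have "no_common_miss u v" using connected u v by blast
    then show False using u v M by (auto simp: no_common_miss_def)
  qed
  then show ?thesis using mM by blast
qed

text \<open>
  Numbering the edges of the matching, and giving the missed vertex (if any) the next number, puts
  vertices with equal labels on a common edge. The bound \<open>2 * g x < card V\<close> says that
  \<open>(card V + 1) div 2\<close> labels suffice: \<open>card V\<close> is twice the number of edges, plus one exactly when
  the extra label occurs.
\<close>

lemma matching_labelling:
  assumes M: "matching M" and miss: "card (V - \<Union>M) \<le> 1"
  shows "\<exists>g :: 'a \<Rightarrow> nat. (\<forall>x\<in>V. 2 * g x < card V)
    \<and> (\<forall>x\<in>V. \<forall>y\<in>V. g x = g y \<longrightarrow> x = y \<or> {x, y} \<in> E)"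
proof -
  obtain h where h: "bij_betw h M {0..<card M}"
    using ex_bij_betw_finite_nat[OF matching_finite[OF M]] by blast
  define cell where "cell x = (THE e. e \<in> M \<and> x \<in> e)" for x
  have cell_eq: "cell x = e" if "e \<in> M" "x \<in> e" for x e
    unfolding cell_def
    by (rule the_equality) (use that M in \<open>auto simp: matching_def disjoint_def\<close>)
  define g where "g x = (if x \<in> \<Union>M then h (cell x) else card M)" for x
  have finite_UM: "finite (\<Union>M)"
    using M matching_Union_subset finite_V finite_subset by blast
  have hlt: "h e < card M" if "e \<in> M" for e using h that by (auto simp: bij_betw_def)
  have V: "card V = 2 * card M + card (V - \<Union>M)"
    using card_Union_matching[OF M] matching_Union_subset[OF M] finite_V
    by (metis card_Diff_subset finite_UM card_mono le_add_diff_inverse)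
  have "2 * g x < card V" if x: "x \<in> V" for x
  proof (cases "x \<in> \<Union>M")
    case True
    then have "cell x \<in> M" using cell_eq by auto
    then have "h (cell x) < card M" by (rule hlt)
    then show ?thesis using V True by (simp add: g_def)
  next
    case False
    then have "card (V - \<Union>M) \<noteq> 0" using x finite_V by auto
    then show ?thesis using V False by (simp add: g_def)
  qed
  moreover have "x = y \<or> {x, y} \<in> E" if xy: "x \<in> V" "y \<in> V" "g x = g y" for x y
  proof (cases "x \<in> \<Union>M")
    case True
    then obtain e where e: "e \<in> M" "x \<in> e" by blast
    then have gx: "g x = h e" using cell_eq g_def True by simp
    have "y \<in> \<Union>M"
      using gx hlt[OF e(1)] xy(3) unfolding g_def by (metis less_irrefl)
    then obtain f where f: "f \<in> M" "y \<in> f" by blast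
    then have "g y = h f" using cell_eq g_def by auto
    then have "e = f" using gx xy(3) h e f by (auto simp: bij_betw_def inj_on_def)
    moreover have "e \<in> E" using e M by (auto simp: matching_def)
    ultimately show ?thesis using edge_obtain_other[of e x] e f by auto
  next
    case False
    then have "g x = card M" by (simp add: g_def)
    moreover have "g y = h f" if "f \<in> M" "y \<in> f" for f
      using that cell_eq g_def by auto
    ultimately have "y \<notin> \<Union>M" using xy(3) hlt by fastforce
    then have "{x, y} \<subseteq> V - \<Union>M" using False xy by blast
    then have "card {x, y} \<le> 1"
      using miss card_mono[of "V - \<Union>M" "{x, y}"] finite_V by auto
    then show ?thesis by (cases "x = y") auto
  qed
  ultimately show ?thesis by blast
qed

end

section \<open>Kneser graphs with at most one spare element\<close>

definition k_subsets :: "nat \<Rightarrow> nat \<Rightarrow> nat set set" where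
  "k_subsets n k = {A. A \<subseteq> {1..n} \<and> card A = k}"

definition kneser_edges :: "nat \<Rightarrow> nat \<Rightarrow> nat set set set" where
  "kneser_edges n k = {{A, B} | A B. A \<in> k_subsets n k \<and> B \<in> k_subsets n k \<and> A \<inter> B = {}}"

lemma k_subsetD:
  assumes "A \<in> k_subsets n k"
  shows "A \<subseteq> {1..n}" "finite A" "card A = k"
  using assms finite_subset by (auto simp: k_subsets_def)

lemma card_k_subsets: "card (k_subsets n k) = n choose k"
  unfolding k_subsets_def using n_subsets[of "{1..n}" k] by simp

lemma kneser_edge_iff:
  "{A, B} \<in> kneser_edges n k \<longleftrightarrow> A \<in> k_subsets n k \<and> B \<in> k_subsets n k \<and> A \<inter> B = {}"
  unfolding kneser_edges_def by (auto simp: doubleton_eq_iff)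

lemma kneser_edgeE:
  assumes "e \<in> kneser_edges n k"
  obtains A B where "e = {A, B}" "A \<in> k_subsets n k" "B \<in> k_subsets n k" "A \<inter> B = {}"
  using assms unfolding kneser_edges_def mem_Collect_eq by (elim exE conjE)

lemma finite_simple_graph_kneser:
  assumes "k > 0"
  shows "finite_simple_graph (k_subsets n k) (kneser_edges n k)"
proof
  show "finite (k_subsets n k)" by (simp add: k_subsets_def)
  fix e assume "e \<in> kneser_edges n k"
  then obtain A B where AB: "e = {A, B}" "A \<in> k_subsets n k" "B \<in> k_subsets n k" "A \<inter> B = {}"
    by (rule kneser_edgeE)
  then show "e \<subseteq> k_subsets n k" by blast
  have "A \<noteq> B" using AB assms by (auto simp: k_subsets_def)
  then show "card e = 2" using AB by simp
qed

text \<open>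
  A permutation of the ground set carrying \<open>A\<close> to \<open>B\<close> acts on \<open>k\<close>-sets and preserves disjointness.
\<close>

lemma kneser_transitive:
  assumes A: "A \<in> k_subsets n k" and B: "B \<in> k_subsets n k"
  shows "\<exists>\<pi>. inj_on \<pi> (k_subsets n k) \<and> \<pi> A = B \<and> (\<forall>e\<in>kneser_edges n k. \<pi> ` e \<in> kneser_edges n k)"
proof -
  let ?X = "{1..n}"
  have sub: "A \<subseteq> ?X" "B \<subseteq> ?X" "finite A" "finite B" "card A = card B"
    using k_subsetD[OF A] k_subsetD[OF B] by simp_all
  obtain f where f: "bij_betw f A B"
    using finite_same_card_bij[OF sub(3-5)] by blast
  have "card (?X - A) = card (?X - B)" using sub by (simp add: card_Diff_subset)
  then obtain g where g: "bij_betw g (?X - A) (?X - B)"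
    using finite_same_card_bij[of "?X - A" "?X - B"] by blast
  define p where "p x = (if x \<in> A then f x else g x)" for x
  have pA: "bij_betw p A B"
    using f by (subst bij_betw_cong[of _ _ f]) (auto simp: p_def)
  have pA': "bij_betw p (?X - A) (?X - B)"
    using g by (subst bij_betw_cong[of _ _ g]) (auto simp: p_def)
  have "bij_betw p (A \<union> (?X - A)) (B \<union> (?X - B))"
    using pA pA' by (rule bij_betw_combine) blast
  then have p: "inj_on p ?X" "p ` ?X = ?X"
    using sub by (auto simp: bij_betw_def Un_absorb1)
  have img: "p ` C \<in> k_subsets n k" if "C \<in> k_subsets n k" for C
    using that p card_image[of p C] inj_on_subset[of p ?X C] by (auto simp: k_subsets_def)
  have "inj_on ((`) p) (k_subsets n k)"
    by (rule inj_on_subset[OF inj_on_image_Pow[OF p(1)]]) (auto simp: k_subsets_def)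
  moreover have "p ` A = B" using pA by (simp add: bij_betw_def)
  moreover have "(`) p ` e \<in> kneser_edges n k" if "e \<in> kneser_edges n k" for e
  proof -
    obtain C D where CD: "e = {C, D}" "C \<in> k_subsets n k" "D \<in> k_subsets n k" "C \<inter> D = {}"
      using \<open>e \<in> kneser_edges n k\<close> by (rule kneser_edgeE)
    have "p ` C \<inter> p ` D = {}"
      using CD inj_on_image_Int[OF p(1), of C D] by (auto simp: k_subsets_def)
    then show ?thesis using CD img by (simp add: kneser_edge_iff)
  qed
  ultimately show ?thesis by blast
qed

text \<open>
  Exchanging one element \<open>a\<close> of \<open>A\<close> for \<open>b\<close> takes two steps, since both sets are disjoint from the
  complement of \<open>insert b A\<close>, which has exactly \<open>k\<close> elements. Repeated exchanges turn \<open>A\<close> into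
  \<open>B\<close>.
\<close>

lemma odd_kneser_connected:
  assumes "A \<in> k_subsets (2 * k + 1) k" "B \<in> k_subsets (2 * k + 1) k"
  shows "(A, B) \<in> {(x, y). {x, y} \<in> kneser_edges (2 * k + 1) k}\<^sup>*"
  using assms
proof (induction "card (A - B)" arbitrary: A rule: less_induct)
  case less
  let ?X = "{1..2 * k + 1}" and ?R = "{(x, y). {x, y} \<in> kneser_edges (2 * k + 1) k}"
  have A: "A \<subseteq> ?X" "finite A" "card A = k" and B: "B \<subseteq> ?X" "finite B" "card B = k"
    using k_subsetD less.prems by blast+
  show ?case
  proof (cases "A = B")
    case False
    then have "\<not> A \<subseteq> B" "\<not> B \<subseteq> A"
      using A B card_subset_eq[of B A] card_subset_eq[of A B] by auto
    then obtain a b where a: "a \<in> A" "a \<notin> B" and b: "b \<in> B" "b \<notin> A" by blast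
    define A' where "A' = insert b (A - {a})"
    define C where "C = ?X - insert b A"
    have "card A' = k" using A a b unfolding A'_def
      by (metis Diff_iff card.remove card_insert_disjoint finite_Diff)
    then have A': "A' \<in> k_subsets (2 * k + 1) k"
      using A B b by (auto simp: k_subsets_def A'_def)
    have "insert b A \<subseteq> ?X" using A B b by blast
    then have C: "C \<in> k_subsets (2 * k + 1) k"
      unfolding C_def k_subsets_def using A b by (simp add: card_Diff_subset)
    have "A' - B = (A - B) - {a}" using b by (auto simp: A'_def)
    then have "card (A' - B) < card (A - B)"
      using a A by (metis DiffI card_Diff1_less finite_Diff)
    then have "(A', B) \<in> ?R\<^sup>*"
      using less.hyps A' less.prems by blast
    have "{A, C} \<in> kneser_edges (2 * k + 1) k" "{C, A'} \<in> kneser_edges (2 * k + 1) k"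
      using less.prems A' C by (auto simp: kneser_edge_iff C_def A'_def)
    then have "(A, C) \<in> ?R" "(C, A') \<in> ?R" by simp_all
    then show ?thesis
      using \<open>(A', B) \<in> ?R\<^sup>*\<close> by (blast intro: converse_rtrancl_into_rtrancl)
  qed simp
qed

lemma kneser_labelling:
  assumes "k > 0" "n = 2 * k \<or> n = 2 * k + 1"
  shows "\<exists>g :: nat set \<Rightarrow> nat. (\<forall>A\<in>k_subsets n k. 2 * g A < n choose k)
    \<and> (\<forall>A\<in>k_subsets n k. \<forall>B\<in>k_subsets n k. g A = g B \<longrightarrow> A = B \<or> A \<inter> B = {})"
proof -
  interpret finite_simple_graph "k_subsets n k" "kneser_edges n k"
    using assms by (intro finite_simple_graph_kneser)
  have "\<exists>M. matching M \<and> card (k_subsets n k - \<Union>M) \<le> 1"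
    using assms(2)
  proof
    assume n: "n = 2 * k"
    let ?M = "kneser_edges n k"
    have compl: "B = {1..n} - A"
      if "A \<in> k_subsets n k" "B \<in> k_subsets n k" "A \<inter> B = {}" for A B
    proof (rule card_subset_eq)
      show "B \<subseteq> {1..n} - A" using that by (auto simp: k_subsets_def)
      show "card B = card ({1..n} - A)"
        using k_subsetD[OF that(1)] k_subsetD[OF that(2)] n by (simp add: card_Diff_subset)
    qed simp
    have "matching ?M"
      unfolding matching_def disjoint_def
    proof (intro conjI subset_refl ballI impI)
      fix e f assume ef: "e \<in> ?M" "f \<in> ?M" "e \<noteq> f"
      have "e = {A, {1..n} - A}" if eA: "e \<in> ?M" "A \<in> e" for e A
      proof -
        obtain C D where CD: "e = {C, D}" "C \<in> k_subsets n k" "D \<in> k_subsets n k" "C \<inter> D = {}"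
          using eA(1) by (rule kneser_edgeE)
        have "D = {1..n} - C" using compl CD by blast
        moreover have "C = {1..n} - D" using compl CD by blast
        ultimately show ?thesis using eA(2) CD(1) by blast
      qed
      then show "e \<inter> f = {}" using ef by blast
    qed
    moreover have "A \<in> \<Union>?M" if A: "A \<in> k_subsets n k" for A
    proof -
      have "{1..n} - A \<in> k_subsets n k"
        using k_subsetD[OF A] n by (auto simp: k_subsets_def card_Diff_subset)
      then have "{A, {1..n} - A} \<in> ?M" using A by (simp add: kneser_edge_iff)
      then show ?thesis by blast
    qed
    then have "k_subsets n k - \<Union>?M = {}" by blast
    ultimately show ?thesis by (metis card.empty zero_le)
  next
    assume "n = 2 * k + 1"
    then show ?thesis
      using near_perfect_matching_if_vertex_transitive[OF odd_kneser_connected[of _ k, folded \<open>n = 2 * k + 1\<close>]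
          kneser_transitive[of _ n k]]
      by blast
  qed
  then obtain M where M: "matching M" "card (k_subsets n k - \<Union>M) \<le> 1" by blast
  obtain g :: "nat set \<Rightarrow> nat" where
    "\<forall>A\<in>k_subsets n k. 2 * g A < n choose k"
    "\<forall>A\<in>k_subsets n k. \<forall>B\<in>k_subsets n k. g A = g B \<longrightarrow> A = B \<or> {A, B} \<in> kneser_edges n k"
    using matching_labelling[OF M] unfolding card_k_subsets by (elim exE conjE)
  then show ?thesis unfolding kneser_edge_iff by (intro exI[of _ g]) simp
qed

section \<open>Chains ending in the middle level\<close>

text \<open>
  Read a set as a walk that goes up at positions in \<open>A\<close> and down at the others. If
  \<open>2 * card A < n\<close>, the walk ends below its start, so its first minimum is reached by a down-step.
  Turning that step into an up-step adds the element \<open>pivot n A\<close>. In the new walk, the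
  position just before the pivot is the last minimum, so the pivot can be read off from the result.
  In terms of parenthesis matching, this flips the last unmatched closing parenthesis.
\<close>

definition height :: "nat set \<Rightarrow> nat \<Rightarrow> int" where
  "height A j = 2 * int (card (A \<inter> {1..j})) - int j"

definition pivot :: "nat \<Rightarrow> nat set \<Rightarrow> nat" where
  "pivot n A = (LEAST j. j \<le> n \<and> (\<forall>i\<le>n. height A j \<le> height A i))"

definition raise :: "nat \<Rightarrow> nat set \<Rightarrow> nat set" where
  "raise n A = insert (pivot n A) A"

lemma height_0 [simp]: "height A 0 = 0"
  by (simp add: height_def)

lemma height_Suc: "height A (Suc j) = height A j + (if Suc j \<in> A then 1 else - 1)"
proof -
  have "A \<inter> {1..Suc j} = (if Suc j \<in> A then insert (Suc j) (A \<inter> {1..j}) else A \<inter> {1..j})"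
    by (auto simp: le_Suc_eq)
  then show ?thesis by (simp add: height_def)
qed

lemma pivot_is_argmin: "pivot n A \<le> n" "i \<le> n \<Longrightarrow> height A (pivot n A) \<le> height A i"
proof -
  obtain j where "is_arg_min (height A) (\<lambda>j. j \<in> {..n}) j"
    using ex_is_arg_min_if_finite[of "{..n}" "height A"] by auto
  then have "j \<le> n \<and> (\<forall>i\<le>n. height A j \<le> height A i)"
    by (auto simp: is_arg_min_def not_less)
  then have "pivot n A \<le> n \<and> (\<forall>i\<le>n. height A (pivot n A) \<le> height A i)"
    unfolding pivot_def by (rule LeastI)
  then show "pivot n A \<le> n" "i \<le> n \<Longrightarrow> height A (pivot n A) \<le> height A i" by auto
qed

lemma height_before_pivot:
  assumes "i < pivot n A"
  shows "height A (pivot n A) < height A i"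
proof (rule ccontr)
  assume "\<not> height A (pivot n A) < height A i"
  then have "i \<le> n \<and> (\<forall>j\<le>n. height A i \<le> height A j)"
    using pivot_is_argmin[where n = n and A = A] assms by force
  then have "pivot n A \<le> i" unfolding pivot_def by (rule Least_le)
  then show False using assms by simp
qed

lemma pivot_step:
  assumes "A \<subseteq> {1..n}" "2 * card A < n"
  obtains q where "pivot n A = Suc q" "Suc q \<notin> A" "height A q = height A (pivot n A) + 1"
proof -
  have "A \<inter> {1..n} = A" using assms by blast
  then have "height A n < 0" using assms(2) by (simp add: height_def)
  then have "pivot n A \<noteq> 0" using pivot_is_argmin(2)[of n n A] by (metis height_0 le_refl not_less)
  then obtain q where q: "pivot n A = Suc q" using not0_implies_Suc by blast
  have "height A (Suc q) < height A q" using height_before_pivot[of q n A] q by simp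
  then have "Suc q \<notin> A" "height A q = height A (Suc q) + 1"
    using height_Suc[of A q] by (auto split: if_splits)
  then show ?thesis using that q by simp
qed

lemma raise_subset: "A \<subseteq> {1..n} \<Longrightarrow> 2 * card A < n \<Longrightarrow> raise n A \<subseteq> {1..n}"
  using pivot_step[of A n] pivot_is_argmin(1)[of n A] unfolding raise_def
  by (metis atLeastAtMost_iff insert_subset le_add1 plus_1_eq_Suc)

lemma card_raise:
  assumes "A \<subseteq> {1..n}" "2 * card A < n"
  shows "card (raise n A) = Suc (card A)"
proof -
  have "pivot n A \<notin> A" using pivot_step[OF assms] by metis
  moreover have "finite A" using assms(1) by (rule finite_subset) simp
  ultimately show ?thesis by (simp add: raise_def)
qed

lemma height_raise:
  assumes "A \<subseteq> {1..n}" "2 * card A < n"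
  shows "height (raise n A) j = height A j + (if pivot n A \<le> j then 2 else 0)"
proof -
  obtain q where q: "pivot n A = Suc q" "Suc q \<notin> A" using pivot_step[OF assms] by metis
  have "raise n A \<inter> {1..j} = (if pivot n A \<le> j then insert (Suc q) (A \<inter> {1..j}) else A \<inter> {1..j})"
    using q by (auto simp: raise_def)
  then show ?thesis using q by (simp add: height_def)
qed

text \<open>
  Flipping the step lifts the walk by \<open>2\<close> from the pivot on, so the old minimum is now \<open>1\<close> above
  the value at \<open>q\<close>, whereas before the pivot the walk never was below that value.
\<close>

lemma pivot_recoverable:
  assumes A: "A \<subseteq> {1..n}" "2 * card A < n" and q: "pivot n A = Suc q" and "i \<le> n"
  shows "i \<le> q \<Longrightarrow> height (raise n A) q \<le> height (raise n A) i"
    and "q < i \<Longrightarrow> height (raise n A) q < height (raise n A) i"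
proof -
  have hq: "height A q = height A (pivot n A) + 1"
    using pivot_step[OF A] q by (metis nat.inject)
  show "height (raise n A) q \<le> height (raise n A) i" if "i \<le> q"
    using height_before_pivot[of i n A] that q hq by (simp add: height_raise[OF A])
  show "height (raise n A) q < height (raise n A) i" if "q < i"
    using pivot_is_argmin(2)[of i n A] that q hq \<open>i \<le> n\<close> by (simp add: height_raise[OF A])
qed

lemma raise_inj:
  assumes A: "A \<subseteq> {1..n}" "2 * card A < n" and B: "B \<subseteq> {1..n}" "2 * card B < n"
    and eq: "raise n A = raise n B"
  shows "A = B"
proof -
  obtain p where p: "pivot n A = Suc p" "Suc p \<notin> A" using pivot_step[OF A] by metis
  obtain q where q: "pivot n B = Suc q" "Suc q \<notin> B" using pivot_step[OF B] by metis
  have le: "p \<le> n" "q \<le> n"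
    using p q pivot_is_argmin(1)[of n A] pivot_is_argmin(1)[of n B] by auto
  have "p = q"
    using pivot_recoverable[OF A p(1) le(2)] pivot_recoverable[OF B q(1) le(1)] eq
    by (metis leD linorder_neqE_nat order_less_imp_le)
  then show ?thesis using eq p q unfolding raise_def by (metis insert_ident)
qed

lemma raise_iterate:
  assumes "A \<subseteq> {1..n}" "card A + m \<le> n div 2"
  shows "(raise n ^^ m) A \<subseteq> {1..n} \<and> card ((raise n ^^ m) A) = card A + m \<and> A \<subseteq> (raise n ^^ m) A"
  using assms(2)
proof (induction m)
  case 0
  then show ?case using assms by simp
next
  case (Suc m)
  let ?B = "(raise n ^^ m) A"
  have B: "?B \<subseteq> {1..n}" "card ?B = card A + m" "A \<subseteq> ?B" using Suc by auto
  moreover have "2 * card ?B < n" using B Suc.prems by linarith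
  ultimately show ?case
    using raise_subset[of ?B n] card_raise[of ?B n] subset_insertI[of ?B "pivot n ?B"]
    by (simp add: raise_def[of n ?B] subset_insertI2)
qed

lemma raise_iterate_inj:
  assumes "A \<subseteq> {1..n}" "card A + m \<le> n div 2" "B \<subseteq> {1..n}" "card B + m \<le> n div 2"
    and "(raise n ^^ m) A = (raise n ^^ m) B"
  shows "A = B"
  using assms(2,4,5)
proof (induction m)
  case (Suc m)
  let ?A = "(raise n ^^ m) A" and ?B = "(raise n ^^ m) B"
  have "?A \<subseteq> {1..n}" "2 * card ?A < n" "?B \<subseteq> {1..n}" "2 * card ?B < n"
    using raise_iterate[OF assms(1), of m] raise_iterate[OF assms(3), of m] Suc.prems by auto
  then have "?A = ?B" using raise_inj[of ?A n ?B] Suc.prems(3) by simp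
  then show ?case using Suc by simp
qed simp

text \<open>
  The map \<open>raise\<close> links the subsets of size at most \<open>n div 2\<close> into chains; a chain is identified by
  its member in the middle level.
\<close>

definition chain_top :: "nat \<Rightarrow> nat set \<Rightarrow> nat set" where
  "chain_top n A = (raise n ^^ (n div 2 - card A)) A"

lemma chain_top_middle:
  assumes "A \<subseteq> {1..n}" "card A \<le> n div 2"
  shows "chain_top n A \<in> k_subsets n (n div 2)" "A \<subseteq> chain_top n A"
  using raise_iterate[OF assms(1), of "n div 2 - card A"] assms(2)
  by (auto simp: chain_top_def k_subsets_def)

lemma same_chain_top_subset:
  assumes A: "A \<subseteq> {1..n}" and B: "B \<subseteq> {1..n}" "card B \<le> n div 2"
    and le: "card A \<le> card B" and eq: "chain_top n A = chain_top n B"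
  shows "A \<subseteq> B"
proof -
  let ?A = "(raise n ^^ (card B - card A)) A"
  have it: "?A \<subseteq> {1..n}" "card ?A = card B" "A \<subseteq> ?A"
    using raise_iterate[OF A, of "card B - card A"] B le by auto
  have "n div 2 - card A = (n div 2 - card B) + (card B - card A)" using B le by simp
  then have "chain_top n A = (raise n ^^ (n div 2 - card B)) ?A"
    unfolding chain_top_def by (simp only: funpow_add o_apply)
  then have "?A = B"
    using raise_iterate_inj[of ?A n "n div 2 - card B" B] it B eq by (simp add: chain_top_def)
  then show ?thesis using it by simp
qed

section \<open>Colouring the partitions\<close>

lemma QI2_vert_iff:
  "P \<in> QI2_verts n \<longleftrightarrow>
    (\<exists>A. P = {A, {1..n} - A} \<and> A \<subseteq> {1..n} \<and> 2 \<le> card A \<and> 2 \<le> card ({1..n} - A))"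
proof
  assume P: "P \<in> QI2_verts n"
  then obtain A B where AB: "P = {A, B}" "A \<noteq> B"
    by (auto simp: QI2_verts_def card_2_iff)
  then have "A \<union> B = {1..n}" "A \<inter> B = {}"
    using P by (auto simp: QI2_verts_def partition_on_def disjoint_def)
  then have "B = {1..n} - A" "A \<subseteq> {1..n}" by auto
  then show "\<exists>A. P = {A, {1..n} - A} \<and> A \<subseteq> {1..n} \<and> 2 \<le> card A \<and> 2 \<le> card ({1..n} - A)"
    using AB P by (auto simp: QI2_verts_def)
next
  assume "\<exists>A. P = {A, {1..n} - A} \<and> A \<subseteq> {1..n} \<and> 2 \<le> card A \<and> 2 \<le> card ({1..n} - A)"
  then obtain A where A: "P = {A, {1..n} - A}" "A \<subseteq> {1..n}" "2 \<le> card A" "2 \<le> card ({1..n} - A)"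
    by blast
  have "A \<noteq> {}" "{1..n} - A \<noteq> {}" using A by (metis card.empty not_numeral_le_zero)+
  moreover have "A \<noteq> {1..n} - A" using \<open>A \<noteq> {}\<close> by blast
  moreover have "A \<union> ({1..n} - A) = {1..n}" using A(2) by blast
  ultimately show "P \<in> QI2_verts n"
    using A unfolding QI2_verts_def partition_on_def disjoint_def by auto
qed

lemma QI2_vert_small_part:
  assumes "P \<in> QI2_verts n"
  obtains A where "A \<subseteq> {1..n}" "card A \<le> n div 2" "P = {A, {1..n} - A}"
proof -
  obtain A where A: "P = {A, {1..n} - A}" "A \<subseteq> {1..n}"
    using assms by (auto simp: QI2_vert_iff)
  have "finite A" using A finite_subset by blast
  then have "card ({1..n} - A) = n - card A" using A by (simp add: card_Diff_subset)
  then consider "card A \<le> n div 2" | "card ({1..n} - A) \<le> n div 2" by linarith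
  then show ?thesis
  proof cases
    case 2
    have "{1..n} - ({1..n} - A) = A" using A by blast
    then show ?thesis using that[of "{1..n} - A"] 2 A by auto
  qed (use that A in blast)
qed

text \<open>
  A partition is coloured by the label of the top of the chain through its small part. When the two
  parts have equal size, the choice of the small part is arbitrary. Equal colours mean that the chain tops are equal or disjoint, hence that the small parts are comparable or
  disjoint, and then some part of one partition misses some part of the other.
\<close>

lemma QI2_colourable:
  assumes "n \<ge> 2"
  shows "colourable (QI2 n) (((n choose (n div 2)) + 1) div 2)"
proof -
  let ?k = "n div 2"
  have "0 < ?k" "n = 2 * ?k \<or> n = 2 * ?k + 1" using assms by presburger+
  from kneser_labelling[OF this] obtain g :: "nat set \<Rightarrow> nat" where
    g_less: "\<forall>A\<in>k_subsets n ?k. 2 * g A < n choose ?k" and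
    g_eq: "\<forall>A\<in>k_subsets n ?k. \<forall>B\<in>k_subsets n ?k. g A = g B \<longrightarrow> A = B \<or> A \<inter> B = {}"
    by (elim exE conjE)
  have "\<forall>P. \<exists>A. P \<in> QI2_verts n \<longrightarrow> A \<subseteq> {1..n} \<and> card A \<le> ?k \<and> P = {A, {1..n} - A}"
    using QI2_vert_small_part by metis
  then obtain small where small:
    "\<And>P. P \<in> QI2_verts n \<Longrightarrow> small P \<subseteq> {1..n}"
    "\<And>P. P \<in> QI2_verts n \<Longrightarrow> card (small P) \<le> ?k"
    "\<And>P. P \<in> QI2_verts n \<Longrightarrow> P = {small P, {1..n} - small P}"
    by metis
  define c where "c P = g (chain_top n (small P))" for P
  have top: "chain_top n (small P) \<in> k_subsets n ?k" "small P \<subseteq> chain_top n (small P)"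
    if "P \<in> QI2_verts n" for P
    using chain_top_middle small that by auto
  have "0 < n choose ?k" by simp
  then have "c P < ((n choose ?k) + 1) div 2" if "P \<in> QI2_verts n" for P
    using bspec[OF g_less top(1)[OF that]] unfolding c_def by linarith
  moreover have "\<not> qualitatively_independent P Q"
    if P: "P \<in> QI2_verts n" and Q: "Q \<in> QI2_verts n" and eq: "c P = c Q" for P Q
  proof -
    let ?A = "small P" and ?B = "small Q"
    have parts: "?A \<in> P" "{1..n} - ?A \<in> P" "?B \<in> Q" "{1..n} - ?B \<in> Q"
      using small(3)[OF P] small(3)[OF Q] by (metis insertI1 insertI2)+
    consider "chain_top n ?A = chain_top n ?B" | "chain_top n ?A \<inter> chain_top n ?B = {}"
      using g_eq top(1) P Q eq unfolding c_def by blast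
    then have "?A \<subseteq> ?B \<or> ?B \<subseteq> ?A \<or> ?A \<inter> ?B = {}"
    proof cases
      case 1
      then show ?thesis
        using same_chain_top_subset[of ?A n ?B] same_chain_top_subset[of ?B n ?A] small P Q
        by (metis nat_le_linear)
    next
      case 2
      then show ?thesis using top(2) P Q by blast
    qed
    then show ?thesis
    proof (elim disjE)
      assume "?A \<subseteq> ?B"
      then have "?A \<inter> ({1..n} - ?B) = {}" by blast
      then show ?thesis using parts unfolding qualitatively_independent_def by blast
    next
      assume "?B \<subseteq> ?A"
      then have "({1..n} - ?A) \<inter> ?B = {}" by blast
      then show ?thesis using parts unfolding qualitatively_independent_def by blast
    next
      assume "?A \<inter> ?B = {}"
      then show ?thesis using parts unfolding qualitatively_independent_def by blast
    qed
  qed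
  ultimately show ?thesis
    unfolding colourable_def by (intro exI[of _ c]) (auto simp: QI2_def)
qed

text \<open>
  Since the sizes agree, neither of \<open>A\<close> and \<open>B\<close> contains the other, so the only empty
  intersections possible are \<open>A \<inter> B\<close> and that of the complements. The latter makes
  \<open>A \<union> B\<close> everything, which two sets of size \<open>n div 2\<close> achieve only without overlap.
\<close>

lemma dependent_middle_partitions_disjoint:
  assumes A: "A \<in> k_subsets n (n div 2)" and B: "B \<in> k_subsets n (n div 2)" and "A \<noteq> B"
    and dep: "\<not> qualitatively_independent {A, {1..n} - A} {B, {1..n} - B}"
  shows "A \<inter> B = {}"
proof -
  have sub: "A \<subseteq> {1..n}" "B \<subseteq> {1..n}" "finite A" "finite B" "card A = n div 2" "card B = n div 2"
    using k_subsetD[OF A] k_subsetD[OF B] by simp_all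
  have "\<not> A \<subseteq> B" "\<not> B \<subseteq> A"
    using sub \<open>A \<noteq> B\<close> card_subset_eq[of B A] card_subset_eq[of A B] by auto
  then have "A \<inter> ({1..n} - B) \<noteq> {}" "({1..n} - A) \<inter> B \<noteq> {}" using sub by blast+
  then have "A \<inter> B = {} \<or> ({1..n} - A) \<inter> ({1..n} - B) = {}"
    using dep unfolding qualitatively_independent_def by auto
  then show ?thesis
  proof
    assume "({1..n} - A) \<inter> ({1..n} - B) = {}"
    then have "A \<union> B = {1..n}" using sub by blast
    then have "card A + card B = n + card (A \<inter> B)"
      using card_Un_Int[OF sub(3,4)] by simp
    then have "card (A \<inter> B) = 0" using sub by linarith
    then show ?thesis using sub by simp
  qed
qed

text \<open>
  Two is the largest size of a colour class among the middle-level sets, because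
  \<open>3 * (n div 2) > n\<close> for \<open>n \<ge> 4\<close>; this is where \<open>n = 3\<close> would fail.
\<close>

lemma QI2_colours_lower_bound:
  assumes n: "n \<ge> 4" and "colourable (QI2 n) K"
  shows "n choose (n div 2) \<le> 2 * K"
proof -
  let ?S = "k_subsets n (n div 2)"
  obtain c where c: "\<And>P. P \<in> QI2_verts n \<Longrightarrow> c P < K" and
    proper: "\<And>P Q. P \<in> QI2_verts n \<Longrightarrow> Q \<in> QI2_verts n \<Longrightarrow> c P = c Q \<Longrightarrow> \<not> qualitatively_independent P Q"
    using assms(2) unfolding colourable_def QI2_def by auto
  define d where "d A = c {A, {1..n} - A}" for A
  have vert: "{A, {1..n} - A} \<in> QI2_verts n" if A: "A \<in> ?S" for A
    unfolding QI2_vert_iff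
    by (rule exI[of _ A])
       (use n k_subsetD[OF A] in \<open>auto simp: card_Diff_subset\<close>)
  have dlt: "d A < K" if "A \<in> ?S" for A using c vert that by (simp add: d_def)
  have disj: "A \<inter> B = {}" if "A \<in> ?S" "B \<in> ?S" "A \<noteq> B" "d A = d B" for A B
    using dependent_middle_partitions_disjoint that proper vert unfolding d_def by blast
  have finS: "finite ?S" by (simp add: k_subsets_def)
  have fibre: "card {A \<in> ?S. d A = i} \<le> 2" for i
  proof (rule ccontr)
    let ?F = "{A \<in> ?S. d A = i}"
    assume "\<not> card ?F \<le> 2"
    then have "3 \<le> card ?F" by simp
    then obtain T where T: "T \<subseteq> ?F" "card T = 3"
      by (rule obtain_subset_with_card_n)
    have "pairwise disjnt T"
      unfolding pairwise_def disjnt_def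
    proof (intro ballI impI)
      fix A B assume "A \<in> T" "B \<in> T" "A \<noteq> B"
      then show "A \<inter> B = {}" using T(1) by (intro disj) auto
    qed
    moreover have "finite A" if "A \<in> T" for A using that T k_subsetD(2) by blast
    ultimately have "card (\<Union>T) = sum card T" by (rule card_Union_disjoint)
    also have "\<dots> = 3 * (n div 2)"
      using T by (subst sum.cong[of T T card "\<lambda>_. n div 2"]) (auto simp: k_subsets_def)
    finally have "card (\<Union>T) = 3 * (n div 2)" .
    moreover have "card (\<Union>T) \<le> card {1..n}"
      using T by (intro card_mono) (auto simp: k_subsets_def)
    ultimately show False using n by simp
  qed
  have "card ?S = card (\<Union>i<K. {A \<in> ?S. d A = i})"
    using dlt by (intro arg_cong[of _ _ card]) auto
  also have "\<dots> \<le> (\<Sum>i<K. card {A \<in> ?S. d A = i})"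
    by (intro card_UN_le) simp
  also have "\<dots> \<le> (\<Sum>i<K. 2)" by (intro sum_mono fibre)
  finally show ?thesis by (simp add: card_k_subsets mult.commute)
qed

theorem theorem5p3p3:
  fixes n :: nat
  assumes "n \<ge> 4"
  shows "int (chromatic_number (QI2 n)) = \<lceil>1 / 2 * real (n choose (n div 2))\<rceil>"
proof -
  let ?C = "n choose (n div 2)"
  have "chromatic_number (QI2 n) = (?C + 1) div 2"
    unfolding chromatic_number_def
  proof (rule Least_equality)
    show "colourable (QI2 n) ((?C + 1) div 2)" using QI2_colourable assms by simp
    show "(?C + 1) div 2 \<le> K" if "colourable (QI2 n) K" for K
      using QI2_colours_lower_bound[OF assms that] by linarith
  qed
  moreover have "\<lceil>1 / 2 * real ?C\<rceil> = int ((?C + 1) div 2)"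
    by (rule ceiling_unique) linarith+
  ultimately show ?thesis by simp
qed

end
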